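(* Let $p$ be an odd prime. Then: there are infinitely many finite groups $G$ (up to isomorphism) with $|C(G)|=\frac{|G|}{2}$; for every prime $q\neq p$ there are infinitely many finite groups $G$ with $|C(G)|=\frac{|G|}{p^{q-1}}$; and for every integer $k\geq 0$ there are infinitely many finite groups $G$ with $|C(G)|=\frac{|G|}{2}+2^{k}$.
   Context: For a finite group $G$, $C(G)$ denotes the set of all cyclic subgroups of $G$ (including the trivial subgroup). *)

theory Defs
  imports Complex_Main "HOL-Algebra.Elementary_Groups" "HOL-Computational_Algebra.Primes"
begin

definition cyclic_subgroups :: "('a, 'b) monoid_scheme \<Rightarrow> 'a set set" where
  "cyclic_subgroups G = {H. subgroup H G \<and> cyclic_group (G\<lparr>carrier := H\<rparr>)}"

(* Finite groups are represented by those whose elements are natural numbers.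
   Every finite group, over any type, is isomorphic to one of these; see
   finite_group_iso_nat below. *)
definition finite_groups :: "nat monoid set" where
  "finite_groups = {G. group G \<and> finite (carrier G)}"

(* The relation is restricted to groups because two records can satisfy G \<cong> H
   when only one of them is a group: isomorphisms only constrain the operation
   on the carrier, not the designated unit. *)
definition group_isomorphism_rel :: "(nat monoid \<times> nat monoid) set" where
  "group_isomorphism_rel = {(G, H). G \<in> finite_groups \<and> H \<in> finite_groups \<and> G \<cong> H}"

definition infinitely_many_finite_groups :: "(nat monoid \<Rightarrow> bool) \<Rightarrow> bool" where
  "infinitely_many_finite_groups P \<longleftrightarrow>
     infinite ({G \<in> finite_groups. P G} // group_isomorphism_rel)"

lemma equiv_group_isomorphism_rel: "equiv finite_groups group_isomorphism_rel"
proof (rule equivI)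
  show "group_isomorphism_rel \<subseteq> finite_groups \<times> finite_groups"
    by (auto simp: group_isomorphism_rel_def)
  show "refl_on finite_groups group_isomorphism_rel"
    by (auto simp: refl_on_def group_isomorphism_rel_def)
  show "sym group_isomorphism_rel"
    by (auto simp: sym_def group_isomorphism_rel_def finite_groups_def intro: group.iso_sym)
  show "trans group_isomorphism_rel"
    by (auto simp: trans_def group_isomorphism_rel_def intro: iso_trans)
qed

lemma finite_group_iso_nat:
  fixes G :: "('a, 'b) monoid_scheme" (structure)
  assumes "group G" and "finite (carrier G)"
  obtains H where "H \<in> finite_groups" and "G \<cong> H"
proof -
  interpret group G by fact
  obtain f :: "'a \<Rightarrow> nat" where f: "inj_on f (carrier G)"
    using assms(2) finite_imp_inj_to_nat_seg by metis
  define g where "g = inv_into (carrier G) f"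
  define H :: "nat monoid" where
    "H = \<lparr>carrier = f ` carrier G, monoid.mult = (\<lambda>m n. f (g m \<otimes> g n)), one = f \<one>\<rparr>"
  have g: "g (f x) = x" if "x \<in> carrier G" for x
    using that f by (simp add: g_def)
  have "group H"
  proof (rule groupI)
    fix x assume "x \<in> carrier H"
    then obtain a where a: "a \<in> carrier G" "x = f a"
      by (auto simp: H_def)
    then show "\<exists>y\<in>carrier H. y \<otimes>\<^bsub>H\<^esub> x = \<one>\<^bsub>H\<^esub>"
      by (intro bexI[of _ "f (inv a)"]) (auto simp: H_def g)
  qed (auto simp: H_def g m_assoc)
  moreover have "f \<in> iso G H"
    using f by (auto simp: iso_def hom_def bij_betw_def H_def g)
  ultimately show thesis
    using that[of H] assms(2) by (auto simp: finite_groups_def is_iso_def H_def)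
qed

end

theory Submission
  imports Defs "HOL-Algebra.Product_Groups" "HOL-Algebra.Multiplicative_Group" "HOL-Number_Theory.Totient"
begin

text \<open>
  A cyclic subgroup of order \<open>d\<close> has \<open>\<phi>(d)\<close> generators, so the number of cyclic subgroups of a
  finite group is the sum of \<open>1/\<phi>(ord x)\<close> over its elements \<open>x\<close>. Since \<open>\<phi>(2d) = \<phi>(d)\<close> for odd
  \<open>d\<close>, taking the product with an elementary abelian 2-group multiplies both the order and the number
  of cyclic subgroups by the same factor. A cyclic group of order \<open>m\<close> with \<open>d(m)\<close> divisors thus gives
  rise to infinitely many groups in which the ratio is \<open>d(m)/m\<close>. The ratio is \<open>1/2\<close> for \<open>m = 8\<close>,
  \<open>1/p\<close> for \<open>m = 8p\<close>, and \<open>1/p\<^sup>q\<^sup>-\<^sup>1\<close> for \<open>m = 8qp\<^sup>q\<^sup>-\<^sup>1\<close> with \<open>q\<close> odd. For the last claim, an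
  elementary abelian 3-group of order \<open>3\<^sup>n\<close> has \<open>3\<^sup>n/2 + 1/2\<close> cyclic subgroups, so its product with an
  elementary abelian 2-group of order \<open>2\<^sup>k\<^sup>+\<^sup>1\<close> has the required number.
\<close>

section \<open>Cyclic subgroups counted through their generators\<close>

lemma (in group) ord_eq_of_generate_eq:
  assumes "x \<in> carrier G" "y \<in> carrier G" "generate G {y} = generate G {x}"
  shows "ord y = ord x"
  using assms by (simp add: generate_pow_card)

text \<open>Generating inside a subgroup \<open>H\<close> gives the same set as generating inside
  \<open>G\<close>, so a generator of the restricted group also generates \<open>H\<close> in
  \<open>G\<close>. Cyclic subgroups become the image of a map on elements, whose fibres can be
  counted.\<close>

lemma (in group) cyclic_subgroups_eq_generate_image:
  "cyclic_subgroups G = (\<lambda>x. generate G {x}) ` carrier G"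
proof (intro equalityI subsetI)
  fix H assume "H \<in> cyclic_subgroups G"
  then have H: "subgroup H G" and cyc: "cyclic_group (G\<lparr>carrier := H\<rparr>)"
    by (auto simp: cyclic_subgroups_def)
  from cyc obtain x where x: "x \<in> H"
    and gen: "subgroup_generated (G\<lparr>carrier := H\<rparr>) {x} = G\<lparr>carrier := H\<rparr>"
    by (auto simp: cyclic_group_def)
  have "H = carrier (subgroup_generated (G\<lparr>carrier := H\<rparr>) {x})"
    by (simp add: gen)
  also have "\<dots> = generate (G\<lparr>carrier := H\<rparr>) {x}"
    using x by (simp add: carrier_subgroup_generated)
  also have "\<dots> = generate G {x}"
    using x H by (intro generate_consistent) auto
  finally show "H \<in> (\<lambda>x. generate G {x}) ` carrier G"
    using x H subgroup.mem_carrier by fastforce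
next
  fix H assume "H \<in> (\<lambda>x. generate G {x}) ` carrier G"
  then obtain x where x: "x \<in> carrier G" "H = generate G {x}"
    by auto
  then have "subgroup_generated G {x} = G\<lparr>carrier := H\<rparr>"
    by (simp add: subgroup_generated_def)
  then have "cyclic_group (G\<lparr>carrier := H\<rparr>)"
    by (metis cyclic_group_generated)
  moreover have "subgroup H G"
    using x by (simp add: generate_is_subgroup)
  ultimately show "H \<in> cyclic_subgroups G"
    by (simp add: cyclic_subgroups_def)
qed

text \<open>The generators are exactly the powers of \<open>x\<close> whose exponent is coprime to
  \<open>ord x\<close>, and exponents from 1 to \<open>ord x\<close> yield each power once.\<close>

lemma (in group) card_generators_generate:
  assumes fin: "finite (carrier G)" and x: "x \<in> carrier G"
  shows "card {y \<in> carrier G. generate G {y} = generate G {x}} = totient (ord x)"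
proof -
  have pos: "ord x \<ge> 1"
    using ord_ge_1[OF fin x] .
  have finx: "finite (generate G {x})"
    using x by (intro finite_subset[OF generate_incl fin]) auto
  have "{y \<in> carrier G. generate G {y} = generate G {x}} = (\<lambda>k. x [^] k) ` totatives (ord x)"
  proof (intro equalityI subsetI)
    fix y assume "y \<in> {y \<in> carrier G. generate G {y} = generate G {x}}"
    then have y: "y \<in> carrier G" "generate G {y} = generate G {x}"
      by auto
    have "y \<in> generate G {x}"
      using y generate.incl[of y "{y}" G] by simp
    then obtain i :: int where i: "y = x [^] i"
      using generate_pow[OF x] by auto
    \<comment> \<open>Shifting by one before and after the reduction places \<open>k\<close> in 1,
      ..., \<open>ord x\<close> instead of 0, ..., \<open>ord x - 1\<close>. This is the range of
      \<open>totatives\<close>, which contains 1 even when \<open>ord x = 1\<close>.\<close>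
    define k where "k = nat ((i - 1) mod int (ord x)) + 1"
    have "i - int k = (i - 1) - (i - 1) mod int (ord x)"
      using pos by (simp add: k_def)
    then have "int (ord x) dvd i - int k"
      by (metis dvd_minus_mod)
    then have yk: "y = x [^] k"
      using i int_pow_eq[OF x, of "int k" i] by (simp add: int_pow_int)
    have "nat ((i - 1) mod int (ord x)) < ord x"
      using pos by (simp add: nat_less_iff)
    then have "0 < k" "k \<le> ord x"
      by (auto simp: k_def)
    moreover have "coprime k (ord x)"
      using ord_eq_of_generate_eq[OF x y] yk pow_ord_eq_ord_iff[OF fin x] by simp
    ultimately show "y \<in> (\<lambda>k. x [^] k) ` totatives (ord x)"
      using yk by (auto simp: in_totatives_iff)
  next
    fix y assume "y \<in> (\<lambda>k. x [^] k) ` totatives (ord x)"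
    then obtain k where k: "y = x [^] k" "coprime k (ord x)"
      by (auto simp: in_totatives_iff)
    have y: "y \<in> carrier G"
      using x k by simp
    have "y \<in> generate G {x}"
      using k generate_pow[OF x] int_pow_int[of G x k] by (auto intro: exI[of _ "int k"])
    then have "generate G {y} \<subseteq> generate G {x}"
      using generate_subgroup_incl[of "{y}" "generate G {x}"] generate_is_subgroup[of "{x}"] x by simp
    \<comment> \<open>A coprime exponent preserves the order, so the inclusion is between finite
      sets of equal size.\<close>
    moreover have "card (generate G {y}) = card (generate G {x})"
      using pow_ord_eq_ord_iff[OF fin x, of k] k x y generate_pow_card by simp
    ultimately have "generate G {y} = generate G {x}"
      using finx card_subset_eq by blast
    then show "y \<in> {y \<in> carrier G. generate G {y} = generate G {x}}"
      using y by simp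
  qed
  moreover have "inj_on (\<lambda>k. x [^] k) (totatives (ord x))"
    using ord_inj'[OF x] by (rule inj_on_subset) (auto simp: in_totatives_iff)
  ultimately show ?thesis
    by (simp add: card_image totient_def)
qed

text \<open>The sum is split along the fibres of \<open>x \<mapsto> generate G {x}\<close>. All
  elements of a fibre have the same order, and their number cancels the weight, so each fibre
  contributes 1.\<close>

lemma (in group) card_cyclic_subgroups:
  assumes fin: "finite (carrier G)"
  shows "real (card (cyclic_subgroups G)) = (\<Sum>x\<in>carrier G. 1 / real (totient (ord x)))"
proof -
  let ?gen = "\<lambda>x. generate G {x}"
  have "(\<Sum>x\<in>{y \<in> carrier G. ?gen y = H}. 1 / real (totient (ord x))) = 1"
    if "H \<in> ?gen ` carrier G" for H
  proof -
    from that obtain x where x: "x \<in> carrier G" "H = ?gen x"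
      by auto
    have "(\<Sum>y\<in>{y \<in> carrier G. ?gen y = H}. 1 / real (totient (ord y)))
        = (\<Sum>y\<in>{y \<in> carrier G. ?gen y = H}. 1 / real (totient (ord x)))"
    proof (rule sum.cong)
      fix y assume "y \<in> {y \<in> carrier G. ?gen y = H}"
      then have "ord y = ord x"
        using x by (intro ord_eq_of_generate_eq) auto
      then show "1 / real (totient (ord y)) = 1 / real (totient (ord x))"
        by simp
    qed simp
    also have "\<dots> = 1"
      using card_generators_generate[OF fin x(1)] ord_ge_1[OF fin x(1)] x(2) by simp
    finally show ?thesis .
  qed
  then show ?thesis
    by (simp add: cyclic_subgroups_eq_generate_image sum.image_gen[OF fin, of _ ?gen])
qed

section \<open>Isomorphism invariance and infinite families\<close>

lemma ord_iso:
  assumes "group G" "group H" "f \<in> iso G H" "x \<in> carrier G"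
  shows "group.ord H (f x) = group.ord G x"
proof -
  interpret G: group G by fact
  interpret H: group H by fact
  interpret f: group_hom G H f
    using assms by unfold_locales (auto simp: iso_def)
  have inj: "inj_on f (carrier G)"
    using assms by (auto simp: iso_def bij_betw_def)
  have "f x [^]\<^bsub>H\<^esub> n = \<one>\<^bsub>H\<^esub> \<longleftrightarrow> x [^]\<^bsub>G\<^esub> n = \<one>\<^bsub>G\<^esub>" for n :: nat
    using inj_on_eq_iff[OF inj, of "x [^]\<^bsub>G\<^esub> n" "\<one>\<^bsub>G\<^esub>"] assms(4) f.hom_nat_pow[of x n] by simp
  then show ?thesis
    using assms(4) by (simp add: H.ord_unique G.pow_eq_id)
qed

lemma card_cyclic_subgroups_iso:
  assumes G: "group G" "finite (carrier G)" and H: "group H" and "G \<cong> H"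
  shows "card (cyclic_subgroups H) = card (cyclic_subgroups G)"
proof -
  obtain f where f: "f \<in> iso G H"
    using assms by (auto simp: is_iso_def)
  then have bij: "bij_betw f (carrier G) (carrier H)"
    by (simp add: iso_def)
  have "real (card (cyclic_subgroups H)) = (\<Sum>y\<in>carrier H. 1 / real (totient (group.ord H y)))"
    using bij G(2) by (intro group.card_cyclic_subgroups H) (simp add: bij_betw_finite)
  also have "\<dots> = (\<Sum>x\<in>carrier G. 1 / real (totient (group.ord H (f x))))"
    by (rule sum.reindex_bij_betw[OF bij, symmetric])
  also have "\<dots> = (\<Sum>x\<in>carrier G. 1 / real (totient (group.ord G x)))"
    using ord_iso[OF G(1) H f] by simp
  also have "\<dots> = real (card (cyclic_subgroups G))"
    using group.card_cyclic_subgroups[OF G] by simp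
  finally show ?thesis
    by simp
qed

text \<open>Each \<open>G n\<close> is replaced by an isomorphic copy on the natural numbers. The
  property depends only on two isomorphism invariants, so it passes to the copies, and distinct
  orders force distinct isomorphism classes.\<close>

lemma infinitely_many_finite_groupsI:
  fixes G :: "nat \<Rightarrow> ('a, 'b) monoid_scheme" and P :: "nat \<Rightarrow> nat \<Rightarrow> bool"
  assumes grp: "\<And>n. group (G n)" and fin: "\<And>n. finite (carrier (G n))"
    and inj: "inj (\<lambda>n. Coset.order (G n))"
    and P: "\<And>n. P (card (cyclic_subgroups (G n))) (Coset.order (G n))"
  shows "infinitely_many_finite_groups (\<lambda>G. P (card (cyclic_subgroups G)) (Coset.order G))"
proof -
  let ?S = "{G \<in> finite_groups. P (card (cyclic_subgroups G)) (Coset.order G)}"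
  have "\<exists>H. H \<in> finite_groups \<and> G n \<cong> H" for n
    using finite_group_iso_nat[OF grp fin] by metis
  then obtain H where H: "\<And>n. H n \<in> finite_groups" "\<And>n. G n \<cong> H n"
    by metis
  have order: "Coset.order (H n) = Coset.order (G n)" for n
    using iso_same_card[OF H(2)] by (simp add: Coset.order_def)
  have "card (cyclic_subgroups (H n)) = card (cyclic_subgroups (G n))" for n
    using H by (intro card_cyclic_subgroups_iso grp fin) (auto simp: finite_groups_def)
  then have "H n \<in> ?S" for n
    using H(1) P order by simp
  then have sub: "range (\<lambda>n. group_isomorphism_rel `` {H n}) \<subseteq> ?S // group_isomorphism_rel"
    by (auto intro: quotientI)
  have "inj (\<lambda>n. group_isomorphism_rel `` {H n})"
  proof (rule injI)
    fix m n
    assume "group_isomorphism_rel `` {H m} = group_isomorphism_rel `` {H n}"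
    then have "(H m, H n) \<in> group_isomorphism_rel"
      using eq_equiv_class[OF _ equiv_group_isomorphism_rel H(1)] by metis
    then have "Coset.order (H m) = Coset.order (H n)"
      by (simp add: group_isomorphism_rel_def Coset.order_def iso_same_card)
    then show "m = n"
      using inj order by (simp add: inj_def)
  qed
  then have "infinite (range (\<lambda>n. group_isomorphism_rel `` {H n}))"
    by (rule range_inj_infinite)
  then show ?thesis
    unfolding infinitely_many_finite_groups_def by (rule infinite_super[OF sub])
qed

section \<open>Direct products with groups of exponent dividing 2\<close>

text \<open>A power of a pair is trivial exactly when both orders divide the exponent.\<close>

lemma ord_DirProd:
  assumes G: "group G" and H: "group H" and "x \<in> carrier G" "y \<in> carrier H"
  shows "group.ord (G \<times>\<times> H) (x, y) = lcm (group.ord G x) (group.ord H y)"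
proof -
  interpret G: group G by fact
  interpret H: group H by fact
  interpret GH: group "G \<times>\<times> H"
    using G H by (rule DirProd_group)
  have "(x, y) [^]\<^bsub>G \<times>\<times> H\<^esub> n = (x [^]\<^bsub>G\<^esub> n, y [^]\<^bsub>H\<^esub> n)" for n :: nat
    by (induction n) simp_all
  then show ?thesis
    using assms by (simp add: GH.ord_unique G.pow_eq_id H.pow_eq_id)
qed

lemma order_DirProd: "Coset.order (G \<times>\<times> H) = Coset.order G * Coset.order H"
  by (simp add: Coset.order_def card_cartesian_product)

text \<open>The lcm is either \<open>d\<close> or, for odd \<open>d\<close>, possibly
  \<open>2 * d\<close>, and doubling an odd number does not change its totient.\<close>

lemma totient_lcm_dvd_2:
  assumes "e dvd 2"
  shows "totient (lcm d e) = totient d"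
proof -
  have "e = 1 \<or> e = 2"
    using assms prime_nat_iff two_is_prime_nat by blast
  then show ?thesis
  proof
    assume e: "e = 2"
    show ?thesis
    proof (cases "even d")
      case True
      then show ?thesis
        using e by (simp add: lcm_proj1_if_dvd)
    next
      case False
      then have "lcm d e = 2 * d"
        using e lcm_coprime[of d 2] by simp
      then show ?thesis
        using False by (simp add: totient_double)
    qed
  qed simp
qed

text \<open>A pair \<open>(x, y)\<close> carries the same weight as \<open>x\<close>, so the
  weighted sum for \<open>G\<close> is repeated once for every element of \<open>H\<close>.\<close>

lemma card_cyclic_subgroups_DirProd_exponent_2:
  assumes G: "group G" "finite (carrier G)" and H: "group H" "finite (carrier H)"
    and exp: "\<And>y. y \<in> carrier H \<Longrightarrow> group.ord H y dvd 2"
  shows "card (cyclic_subgroups (G \<times>\<times> H)) = card (cyclic_subgroups G) * Coset.order H"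
proof -
  have "real (card (cyclic_subgroups (G \<times>\<times> H)))
      = (\<Sum>z\<in>carrier G \<times> carrier H. 1 / real (totient (group.ord (G \<times>\<times> H) z)))"
    using group.card_cyclic_subgroups[OF DirProd_group[OF G(1) H(1)]] G(2) H(2) by simp
  also have "\<dots> = (\<Sum>(x, y)\<in>carrier G \<times> carrier H. 1 / real (totient (group.ord G x)))"
    using G H exp by (intro sum.cong) (auto simp: ord_DirProd totient_lcm_dvd_2)
  also have "\<dots> = real (card (cyclic_subgroups G)) * real (Coset.order H)"
    by (simp add: sum.cartesian_product [symmetric] group.card_cyclic_subgroups[OF G]
        Coset.order_def sum_distrib_left sum_distrib_right mult.commute)
  finally show ?thesis
    by (metis of_nat_eq_iff of_nat_mult)
qed

section \<open>Groups of prime exponent and homocyclic groups\<close>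

text \<open>The identity has weight 1, and every other element has order \<open>p\<close> and hence
  weight \<open>1 / (p - 1)\<close>.\<close>

lemma card_cyclic_subgroups_prime_exponent:
  fixes G (structure)
  assumes G: "group G" "finite (carrier G)" and p: "Factorial_Ring.prime p"
    and exp: "\<And>x. x \<in> carrier G \<Longrightarrow> group.ord G x dvd p"
  shows "real (card (cyclic_subgroups G)) = 1 + (real (Coset.order G) - 1) / (real p - 1)"
proof -
  interpret group G by fact
  have "ord x = p" if "x \<in> carrier G - {\<one>}" for x
    using that exp[of x] p ord_eq_1[of x] by (auto simp: prime_nat_iff)
  then have "(\<Sum>x\<in>carrier G - {\<one>}. 1 / real (totient (ord x)))
      = real (card (carrier G - {\<one>})) / real (p - 1)"
    using p by (simp add: totient_prime)
  moreover have "real (card (carrier G - {\<one>})) = real (Coset.order G) - 1"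
    using order_gt_0_iff_finite G(2) by (simp add: Coset.order_def card_Diff_singleton of_nat_diff)
  moreover have "real (p - 1) = real p - 1"
    using prime_gt_0_nat[OF p] by (simp add: of_nat_diff)
  ultimately show ?thesis
    by (simp add: card_cyclic_subgroups[OF G(2)] sum.remove[OF G(2) one_closed])
qed

text \<open>For prime \<open>r\<close> this is the elementary abelian group of rank
  \<open>n\<close>. The case \<open>r = 0\<close> would give copies of the integers, whence the
  assumption \<open>r > 0\<close> when the order is computed.\<close>

abbreviation homocyclic_group :: "nat \<Rightarrow> nat \<Rightarrow> (nat \<Rightarrow> int) monoid" where
  "homocyclic_group r n \<equiv> product_group {..<n} (\<lambda>_. integer_mod_group r)"

lemma
  assumes "r > 0"
  shows finite_homocyclic_group: "finite (carrier (homocyclic_group r n))"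
    and order_homocyclic_group: "Coset.order (homocyclic_group r n) = r ^ n"
  using assms by (simp_all add: Coset.order_def carrier_integer_mod_group card_PiE finite_PiE)

lemma ord_homocyclic_group_dvd:
  assumes "x \<in> carrier (homocyclic_group r n)"
  shows "group.ord (homocyclic_group r n) x dvd r"
proof -
  interpret group "homocyclic_group r n" by simp
  have "x [^]\<^bsub>homocyclic_group r n\<^esub> m = (\<lambda>i\<in>{..<n}. x i [^]\<^bsub>integer_mod_group r\<^esub> m)"
    for m :: nat
    by (induction m) (auto simp: nat_pow_def)
  then show ?thesis
    using assms by (simp flip: pow_eq_id)
qed

section \<open>Cyclic groups and divisor counts\<close>

text \<open>Residues are grouped by \<open>d = gcd k m\<close>. Each group has
  \<open>totient (m div d)\<close> members, all of order \<open>m div d\<close>, so every divisor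
  contributes exactly 1 to the weighted sum.\<close>

lemma card_cyclic_subgroups_integer_mod_group:
  assumes m: "m > 0"
  shows "card (cyclic_subgroups (integer_mod_group m)) = card {d. d dvd m}"
proof -
  let ?Z = "integer_mod_group m"
  interpret Z: group ?Z by simp
  have fin: "finite (carrier ?Z)"
    using m by (simp add: carrier_integer_mod_group)
  have ord: "Z.ord (int k mod int m) = m div gcd k m" if "k \<in> {0<..m}" for k
  proof -
    have "int k mod int m \<in> carrier ?Z"
      using m by (simp add: carrier_integer_mod_group)
    moreover have "(int k mod int m) [^]\<^bsub>?Z\<^esub> j = \<one>\<^bsub>?Z\<^esub> \<longleftrightarrow> m div gcd k m dvd j" for j :: nat
    proof -
      have "(int k mod int m) [^]\<^bsub>?Z\<^esub> j = \<one>\<^bsub>?Z\<^esub> \<longleftrightarrow> m dvd j * k"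
        by (simp add: mod_mult_right_eq mod_eq_0_iff_dvd flip: of_nat_mult)
      \<comment> \<open>Both sides say that \<open>m\<close> divides
        \<open>j * gcd k m = gcd (j * k) (j * m)\<close>, since \<open>m\<close> divides
        \<open>j * m\<close> anyway.\<close>
      also have "\<dots> \<longleftrightarrow> m div gcd k m dvd j"
        using m by (simp add: div_dvd_iff_mult gcd_mult_distrib_nat mult.commute)
      finally show ?thesis .
    qed
    ultimately show ?thesis
      by (simp add: Z.ord_unique)
  qed
  \<comment> \<open>The residue 0 is represented by \<open>m\<close>, so that the index set
    \<open>{0<..m}\<close> is the one used by \<open>card_gcd_eq_totient\<close>.\<close>
  have bij: "bij_betw (\<lambda>k. int k mod int m) {0<..m} (carrier ?Z)"
  proof (rule bij_betwI)
    show "(\<lambda>k. int k mod int m) \<in> {0<..m} \<rightarrow> carrier ?Z"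
      using m by (simp add: carrier_integer_mod_group)
    show "(\<lambda>a. if a = 0 then m else nat a) \<in> carrier ?Z \<rightarrow> {0<..m}"
      using m by (auto simp: carrier_integer_mod_group)
    show "(if int k mod int m = 0 then m else nat (int k mod int m)) = k" if "k \<in> {0<..m}" for k
      using that by (cases "k = m") auto
    show "int (if a = 0 then m else nat a) mod int m = a" if "a \<in> carrier ?Z" for a
      using that m by (auto simp: carrier_integer_mod_group)
  qed
  have "real (card (cyclic_subgroups ?Z)) = (\<Sum>k\<in>{0<..m}. 1 / real (totient (m div gcd k m)))"
    using ord by (simp add: Z.card_cyclic_subgroups[OF fin] sum.reindex_bij_betw[OF bij, symmetric])
  also have "\<dots> = (\<Sum>d | d dvd m. \<Sum>k\<in>{k\<in>{0<..m}. gcd k m = d}. 1 / real (totient (m div gcd k m)))"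
    using m by (intro sum.group [symmetric]) auto
  also have "\<dots> = (\<Sum>d | d dvd m. 1)"
  proof (rule sum.cong)
    fix d assume d: "d \<in> {d. d dvd m}"
    have "(\<Sum>k\<in>{k\<in>{0<..m}. gcd k m = d}. 1 / real (totient (m div gcd k m)))
        = (\<Sum>k\<in>{k\<in>{0<..m}. gcd k m = d}. 1 / real (totient (m div d)))"
      by (rule sum.cong) auto
    also have "\<dots> = real (totient (m div d)) / real (totient (m div d))"
      using card_gcd_eq_totient[of m d] m d by simp
    also have "\<dots> = 1"
      using m d by (auto elim!: dvdE)
    finally show "(\<Sum>k\<in>{k\<in>{0<..m}. gcd k m = d}. 1 / real (totient (m div gcd k m))) = 1" .
  qed simp
  finally show ?thesis
    by simp
qed

text \<open>Every divisor of \<open>a * b\<close> splits into a divisor of \<open>a\<close> times a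
  divisor of \<open>b\<close>, and coprimality makes the splitting unique.\<close>

lemma card_divisors_mult_coprime:
  fixes a b :: nat
  assumes "coprime a b"
  shows "card {d. d dvd a * b} = card {d. d dvd a} * card {d. d dvd b}"
proof -
  have "inj_on (\<lambda>(x, y). x * y) ({d. d dvd a} \<times> {d. d dvd b})"
  proof (rule inj_onI, clarsimp)
    fix x y x' y'
    assume dvd: "x dvd a" "y dvd b" "x' dvd a" "y' dvd b" and eq: "x * y = x' * y'"
    have cop: "coprime u v" if "u dvd a" "v dvd b" for u v
      using that assms coprime_divisors by blast
    \<comment> \<open>For instance, \<open>x\<close> divides \<open>x' * y'\<close> and is coprime
      to \<open>y'\<close>, so it divides \<open>x'\<close>.\<close>
    have "x dvd x'" "x' dvd x" "y dvd y'" "y' dvd y"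
      using cop dvd eq coprime_dvd_mult_left_iff coprime_dvd_mult_right_iff coprime_commute
      by (metis dvd_triv_left dvd_triv_right)+
    then show "x = x' \<and> y = y'"
      by (simp add: dvd_antisym)
  qed
  moreover have "(\<lambda>(x, y). x * y) ` ({d. d dvd a} \<times> {d. d dvd b}) = {d. d dvd a * b}"
    by (auto simp: mult_dvd_mono image_iff dest: division_decomp)
  ultimately show ?thesis
    by (metis card_image card_cartesian_product)
qed

lemma card_divisors_prime_power:
  fixes p :: nat
  assumes "Factorial_Ring.prime p"
  shows "card {d. d dvd p ^ k} = Suc k"
proof -
  have "{d. d dvd p ^ k} = (\<lambda>i. p ^ i) ` {..k}"
    using divides_primepow_nat[OF assms] by auto
  moreover have "inj_on (\<lambda>i. p ^ i) {..k}"
    using prime_gt_1_nat[OF assms] by (auto simp: inj_on_def)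
  ultimately show ?thesis
    by (simp add: card_image)
qed

section \<open>The families with the required counts\<close>

text \<open>The factor \<open>homocyclic_group 2 n\<close> multiplies both the order and the number
  of cyclic subgroups by \<open>2 ^ n\<close>. The ratio \<open>1 / c\<close> of the cyclic group of
  order \<open>m\<close> therefore persists while the orders grow.\<close>

lemma infinitely_many_of_divisor_ratio:
  fixes m :: nat and c :: real
  assumes m: "m > 0" and ratio: "real (card {d. d dvd m}) = real m / c"
  shows "infinitely_many_finite_groups
           (\<lambda>G. real (card (cyclic_subgroups G)) = real (Coset.order G) / c)"
proof (rule infinitely_many_finite_groupsI
    [of "\<lambda>n. integer_mod_group m \<times>\<times> homocyclic_group 2 n"
       "\<lambda>a b. real a = real b / c"])
  have fin: "finite (carrier (integer_mod_group m))"
    using m by (simp add: carrier_integer_mod_group)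
  have ordm: "Coset.order (integer_mod_group m) = m"
    using m by (simp add: Coset.order_def carrier_integer_mod_group)
  fix n
  let ?E = "homocyclic_group 2 n"
  show "group (integer_mod_group m \<times>\<times> ?E)"
    by (simp add: DirProd_group)
  show "finite (carrier (integer_mod_group m \<times>\<times> ?E))"
    using fin finite_homocyclic_group[of 2 n] by simp
  show "inj (\<lambda>n. Coset.order (integer_mod_group m \<times>\<times> homocyclic_group 2 n))"
    using m by (simp add: inj_def order_DirProd ordm order_homocyclic_group)
  have "card (cyclic_subgroups (integer_mod_group m \<times>\<times> ?E)) = card {d. d dvd m} * 2 ^ n"
    using card_cyclic_subgroups_DirProd_exponent_2[OF group_integer_mod_group fin, of ?E]
      ord_homocyclic_group_dvd[of _ n 2] finite_homocyclic_group[of 2 n]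
    by (simp add: card_cyclic_subgroups_integer_mod_group[OF m] order_homocyclic_group)
  then show "real (card (cyclic_subgroups (integer_mod_group m \<times>\<times> ?E)))
      = real (Coset.order (integer_mod_group m \<times>\<times> ?E)) / c"
    by (simp add: ratio order_DirProd ordm order_homocyclic_group)
qed

theorem theorem1p1:
  fixes p :: nat
  assumes "Factorial_Ring.prime p" and "odd p"
  shows "infinitely_many_finite_groups
           (\<lambda>G. real (card (cyclic_subgroups G)) = real (Coset.order G) / 2)
       \<and> (\<forall>q::nat. Factorial_Ring.prime q \<and> q \<noteq> p \<longrightarrow>
           infinitely_many_finite_groups
             (\<lambda>G. real (card (cyclic_subgroups G)) = real (Coset.order G) / real p ^ (q - 1)))
       \<and> (\<forall>k::nat. infinitely_many_finite_groups
           (\<lambda>G. real (card (cyclic_subgroups G)) = real (Coset.order G) / 2 + 2 ^ k))"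
proof (intro conjI allI impI)
  have div8: "card {d::nat. d dvd 8} = 4"
    using card_divisors_prime_power[OF two_is_prime_nat, of 3] by simp
  have cop8: "coprime 8 a" if "odd a" for a :: nat
    using that coprime_power_left_iff[of 2 3 a] by simp
  show "infinitely_many_finite_groups
      (\<lambda>G. real (card (cyclic_subgroups G)) = real (Coset.order G) / 2)"
    using div8 by (intro infinitely_many_of_divisor_ratio[of 8]) simp_all
  have p0: "p > 0"
    using assms prime_gt_0_nat by simp
  fix q :: nat
  assume q: "Factorial_Ring.prime q \<and> q \<noteq> p"
  show "infinitely_many_finite_groups
      (\<lambda>G. real (card (cyclic_subgroups G)) = real (Coset.order G) / real p ^ (q - 1))"
  proof (cases "q = 2")
    case True
    \<comment> \<open>Here \<open>p ^ (q - 1) = p\<close>, and \<open>8 * p\<close> has 4 * 2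
      divisors. The number used for odd \<open>q\<close> would not do, as its factor
      \<open>q\<close> must be coprime to 8.\<close>
    have "card {d. d dvd 8 * p} = 8"
      using card_divisors_mult_coprime[OF cop8[OF assms(2)]] div8
        card_divisors_prime_power[OF assms(1), of 1] by simp
    then show ?thesis
      using True p0 by (intro infinitely_many_of_divisor_ratio[of "8 * p"]) simp_all
  next
    case False
    then have odd: "odd q"
      using q primes_dvd_imp_eq two_is_prime_nat by blast
    have q0: "q > 0"
      using q prime_gt_0_nat by blast
    have "coprime q (p ^ (q - 1))"
      using q assms(1) primes_coprime by auto
    then have "card {d. d dvd q * p ^ (q - 1)} = 2 * q"
      using card_divisors_mult_coprime[of q "p ^ (q - 1)"] card_divisors_prime_power[of q 1]
        card_divisors_prime_power[OF assms(1), of "q - 1"] q q0 by simp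
    \<comment> \<open>The factor \<open>p ^ (q - 1)\<close> supplies \<open>q\<close> divisors,
      \<open>q\<close> supplies 2 and 8 supplies 4. The product \<open>8 * q\<close> is what remains
      of the modulus after division by \<open>p ^ (q - 1)\<close>.\<close>
    then have "card {d. d dvd 8 * (q * p ^ (q - 1))} = 8 * q"
      using card_divisors_mult_coprime[OF cop8, of "q * p ^ (q - 1)"] div8 odd assms(2) by simp
    then show ?thesis
      using p0 q0
      by (intro infinitely_many_of_divisor_ratio[of "8 * (q * p ^ (q - 1))"]) simp_all
  qed
next
  fix k :: nat
  \<comment> \<open>The exponent \<open>Suc k\<close> absorbs the denominator 2:
    \<open>(3 ^ n + 1) / 2 * 2 ^ Suc k\<close> equals \<open>3 ^ n * 2 ^ k + 2 ^ k\<close>, whose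
    first term is half the order.\<close>
  let ?G = "\<lambda>n. homocyclic_group 3 n \<times>\<times> homocyclic_group 2 (Suc k)"
  show "infinitely_many_finite_groups
      (\<lambda>G. real (card (cyclic_subgroups G)) = real (Coset.order G) / 2 + 2 ^ k)"
  proof (rule infinitely_many_finite_groupsI[of ?G "\<lambda>a b. real a = real b / 2 + 2 ^ k"])
    fix n
    let ?E3 = "homocyclic_group 3 n" and ?E2 = "homocyclic_group 2 (Suc k)"
    have fin: "finite (carrier ?E3)" "finite (carrier ?E2)"
      by (simp_all only: finite_homocyclic_group zero_less_numeral)
    have grp: "group ?E3" "group ?E2"
      by simp_all
    show "group (?G n)"
      using grp by (rule DirProd_group)
    show "finite (carrier (?G n))"
      using fin by (simp only: carrier_DirProd finite_SigmaI)
    show "inj (\<lambda>n. Coset.order (?G n))"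
      by (simp add: inj_def order_DirProd order_homocyclic_group)
    have "real (card (cyclic_subgroups ?E3)) = (3 ^ n + 1) / 2"
      using card_cyclic_subgroups_prime_exponent[OF grp(1) fin(1), of 3]
        ord_homocyclic_group_dvd[of _ n 3]
      by (simp add: order_homocyclic_group field_simps)
    moreover have "card (cyclic_subgroups (?G n)) = card (cyclic_subgroups ?E3) * 2 ^ Suc k"
      using card_cyclic_subgroups_DirProd_exponent_2[OF grp(1) fin(1) grp(2) fin(2)]
        ord_homocyclic_group_dvd[of _ "Suc k" 2]
      by (simp add: order_homocyclic_group)
    ultimately have "real (card (cyclic_subgroups (?G n))) = (3 ^ n + 1) / 2 * 2 ^ Suc k"
      by simp
    then show "real (card (cyclic_subgroups (?G n))) = real (Coset.order (?G n)) / 2 + 2 ^ k"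
      by (simp add: order_DirProd order_homocyclic_group field_simps)
  qed
qed

end
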